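(* Let $k\ge2$ and $n\ge0$ be integers. (1) Let $Wtr_{2n+1}$, $t_c$, $t_a$ be oriented link diagrams that are identical outside a disk and inside the disk are the tangles of the same names described in the context. Assume that all three diagrams are reduced, alternating and non-split. Then $$CB_{k}(Wtr_{2n+1}) = r^{2n}\,CB_{k}(t_c)+(1-r^{2n})\,CB_{k}(t_a).$$ (2) Let $Btw_{2n+1}$, $t_b$, $t_a$ be oriented link diagrams that are identical outside a disk and inside the disk are the tangles of the same names described in the context. Assume that all three diagrams are reduced, alternating and non-split. Then $$CW_{k}(Btw_{2n+1}) = w^{2n}\,CW_{k}(t_b)+(1-w^{2n})\,CW_{k}(t_a).$$
   Context: Links are oriented. A link diagram is alternating if, travelling along each component, over- and under-crossings alternate. A crossing is nugatory if some circle in the projection plane meets the diagram transversally only at that crossing point. A diagram is reduced if it has no nugatory crossing and its underlying projection is connected. Let $D$ be a reduced alternating diagram. Its regions are the faces of the underlying 4-valent plane graph (including the unbounded face). Checkerboard shading: at each crossing, the two opposite regions swept out when the over-strand is rotated counterclockwise until it meets the under-strand are of type $A$ at that crossing. In a reduced alternating diagram a region is of type $A$ at all of its crossings or at none of them; regions of type $A$ are called black, the others white. The graph $G_B$ has one vertex per black region and one edge per crossing, joining the two black regions that meet at that crossing; $G_W$ is defined in the same way with white regions. Each edge gets weight $w$ if its crossing is positive and $r$ if its crossing is negative (standard crossing sign: with both strands oriented upward, the crossing is positive if the over-strand runs from bottom left to top right). The simple graph $G_B^*$ is obtained from $G_B$ by replacing all edges between the same pair of vertices by one edge whose weight is the product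 of the weights of the replaced edges; $G_W^*$ is obtained from $G_W$ in the same way. Write $wg(e)$ for the weight of an edge $e$. Define $CB_2(w,r)=\sum_{e}wg(e)$, the sum over all edges $e$ of $G_B^*$ ($0$ if there are no edges). For $i>2$ define $CB_i(w,r)=\sum_{C}\prod_{e\in C}wg(e)\in\mathbb{Z}[w,r]$, the sum over all unoriented cycles (simple closed paths) $C$ of length $i$ in $G_B^*$ ($0$ if there are none). Define $CW_i(w,r)$, $i\ge2$, in the same way from $G_W^*$. For a diagram $X$, $CB_i(X)$ and $CW_i(X)$ denote these polynomials computed from $X$. Tangles (all have two strands, both oriented from the bottom to the top of the disk): - $t_a$ is the crossingless tangle of two parallel vertical arcs, both oriented upward; - $t_b$ is a single positive crossing; - $t_c$ is a single negative crossing; - $Btw_{2n+1}$ is a vertical twist (alternating 2-braid on upward strands) with $2n+1$ positive crossings, so that the $2n$ bigons between consecutive crossings are black; - $Wtr_{2n+1}$ is a vertical twist with $2n+1$ negative crossings, so that the $2n$ bigons between consecutive crossings are white. Thus in $G_B$ of $Wtr_{2n+1}$ the $2n+1$ crossings of the tangle are parallel edges of weight $r$, $t_c$ has one such edge, and $t_a$ has none; similarly for $G_W$ with $Btw_{2n+1}$, $t_b$, $t_a$ and weight $w$.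
   Formalization: The formal theorem also assumes that in t_a no crossing joins the two regions left and right of the tangle (no such edge in G_B, resp. G_W); without this it fails, e.g. for 2-braid closures with two further negative crossings, k=2, n=1. *)

theory Defs
  imports "HOL-Combinatorics.Orbits" "HOL-Computational_Algebra.Polynomial"
begin

section \<open>Oriented link diagrams\<close>

text \<open>
  A diagram is given by its oriented signed Gauss data. Travelling along the link one meets
  sites: the passages through a crossing, on the over- or the under-strand, and the passages
  through marked points placed on arcs away from the crossings. The map nxt sends a site to the
  following one. Marked points carry no information (adding or removing them subdivides arcs);
  they allow components without crossings and serve as the end points at which tangles are glued.
\<close>

datatype level = Over | Under

datatype ('c, 'p) site = Crossing 'c level | Point 'p

record ('c, 'p) diagram =
  crossings :: "'c set"
  points :: "'p set"
  positive :: "'c \<Rightarrow> bool"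
  nxt :: "('c, 'p) site \<Rightarrow> ('c, 'p) site"

definition sites :: "('c, 'p) diagram \<Rightarrow> ('c, 'p) site set" where
  "sites D = {Crossing c l | c l. c \<in> crossings D} \<union> Point ` points D"

text \<open>
  A dart is an end of an arc: (v, Out) is the end at which the link leaves the site v, and
  (v, In) the one at which it arrives. The function twin exchanges the two ends of an arc.
\<close>

datatype dir = In | Out

fun flip :: "dir \<Rightarrow> dir" where
  "flip In = Out"
| "flip Out = In"

type_synonym ('c, 'p) dart = "('c, 'p) site \<times> dir"

definition darts :: "('c, 'p) diagram \<Rightarrow> ('c, 'p) dart set" where
  "darts D = sites D \<times> UNIV"

fun twin :: "('c, 'p) diagram \<Rightarrow> ('c, 'p) dart \<Rightarrow> ('c, 'p) dart" where
  "twin D (v, Out) = (nxt D v, In)"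
| "twin D (v, In) = (inv_into (sites D) (nxt D) v, Out)"

text \<open>
  The counterclockwise successor of a dart around its site. With both strands directed upwards,
  the over-strand of a positive crossing runs from bottom left to top right, so the
  counterclockwise order is over-out, under-out, over-in, under-in. At a negative crossing it is
  over-out, under-in, over-in, under-out.
\<close>

fun rot :: "('c, 'p) diagram \<Rightarrow> ('c, 'p) dart \<Rightarrow> ('c, 'p) dart" where
  "rot D (Crossing c Over, d) = (Crossing c Under, if positive D c then d else flip d)"
| "rot D (Crossing c Under, d) = (Crossing c Over, if positive D c then flip d else d)"
| "rot D (Point p, d) = (Point p, flip d)"

text \<open>
  A dart h also stands for the corner swept out when turning counterclockwise from h to
  rot D h. Following the boundary of a region from this corner along the arc starting with
  rot D h leads to the corner twin D (rot D h). Thus a region is recorded as the set of its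
  corners, an orbit of this map. (For a disconnected projection these orbits are the boundary
  cycles of the faces; regions are only used for connected projections, where the two notions
  agree. The unbounded region is a region like any other and needs no distinguished status.)
\<close>

definition region :: "('c, 'p) diagram \<Rightarrow> ('c, 'p) dart \<Rightarrow> ('c, 'p) dart set" where
  "region D h = orbit (\<lambda>x. twin D (rot D x)) h"

definition regions :: "('c, 'p) diagram \<Rightarrow> ('c, 'p) dart set set" where
  "regions D = region D ` darts D"

definition adjacent_sites :: "('c, 'p) diagram \<Rightarrow> (('c, 'p) site \<times> ('c, 'p) site) set" where
  "adjacent_sites D =
     {(v, nxt D v) | v. v \<in> sites D} \<union> {(nxt D v, v) | v. v \<in> sites D} \<union>
     {(Crossing c l, Crossing c l') | c l l'. c \<in> crossings D}"

definition projection_components :: "('c, 'p) diagram \<Rightarrow> ('c, 'p) site set set" where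
  "projection_components D = sites D // (adjacent_sites D)\<^sup>*"

text \<open>
  The last condition is planarity: with V vertices, E arcs and K connected components, of which
  each is drawn on a sphere with F boundary cycles of faces in total, Euler's formula reads
  V - E + F = 2 K, and here E - V is the number of crossings.
\<close>

definition link_diagram :: "('c, 'p) diagram \<Rightarrow> bool" where
  "link_diagram D \<longleftrightarrow>
     finite (crossings D) \<and> finite (points D) \<and>
     bij_betw (nxt D) (sites D) (sites D) \<and>
     card (regions D) = card (crossings D) + 2 * card (projection_components D)"

text \<open>After a passage through a crossing, the next crossing passage is on the other level.\<close>

definition alternating :: "('c, 'p) diagram \<Rightarrow> bool" where
  "alternating D \<longleftrightarrow>
     (\<forall>c l c' l' m. c \<in> crossings D \<longrightarrow>
        (\<forall>j\<in>{1..m}. (nxt D ^^ j) (Crossing c l) \<in> range Point) \<longrightarrow>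
        (nxt D ^^ Suc m) (Crossing c l) = Crossing c' l' \<longrightarrow> l' \<noteq> l)"

definition connected_projection :: "('c, 'p) diagram \<Rightarrow> bool" where
  "connected_projection D \<longleftrightarrow> card (projection_components D) = 1"

definition non_split :: "('c, 'p) diagram \<Rightarrow> bool" where
  "non_split D \<longleftrightarrow> connected_projection D"

text \<open>
  A circle that meets the diagram transversally and only at the crossing c runs, away from c,
  inside one region, which it leaves and enters at opposite corners of c. The corners
  (Crossing c l, Out) and (Crossing c l, In) are opposite.
\<close>

definition nugatory :: "('c, 'p) diagram \<Rightarrow> 'c \<Rightarrow> bool" where
  "nugatory D c \<longleftrightarrow>
     (\<exists>R\<in>regions D. \<exists>l. (Crossing c l, Out) \<in> R \<and> (Crossing c l, In) \<in> R)"

definition reduced :: "('c, 'p) diagram \<Rightarrow> bool" where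
  "reduced D \<longleftrightarrow> connected_projection D \<and> (\<forall>c\<in>crossings D. \<not> nugatory D c)"

definition reduced_alternating_non_split :: "('c, 'p) diagram \<Rightarrow> bool" where
  "reduced_alternating_non_split D \<longleftrightarrow>
     link_diagram D \<and> reduced D \<and> alternating D \<and> non_split D"

section \<open>The checkerboard graphs\<close>

text \<open>
  Turning the over-strand counterclockwise until it meets the under-strand sweeps out the corners
  that start at a dart of the over-strand, that is, the corners (Crossing c Over, d).
\<close>

definition black_regions :: "('c, 'p) diagram \<Rightarrow> ('c, 'p) dart set set" where
  "black_regions D = {R \<in> regions D. \<forall>c l d. (Crossing c l, d) \<in> R \<longrightarrow> l = Over}"

definition white_regions :: "('c, 'p) diagram \<Rightarrow> ('c, 'p) dart set set" where
  "white_regions D = regions D - black_regions D"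

record ('v, 'e, 'a) weighted_multigraph =
  verts :: "'v set"
  edges :: "'e set"
  ends :: "'e \<Rightarrow> 'v set"
  weight :: "'e \<Rightarrow> 'a"

record ('v, 'a) weighted_graph =
  sverts :: "'v set"
  sedges :: "'v set set"
  wg :: "'v set \<Rightarrow> 'a"

definition merge_parallel ::
    "('v, 'e, 'a::comm_monoid_mult) weighted_multigraph \<Rightarrow> ('v, 'a) weighted_graph" where
  "merge_parallel G =
     \<lparr>sverts = verts G,
      sedges = ends G ` edges G,
      wg = (\<lambda>uv. \<Prod>e\<in>{e \<in> edges G. ends G e = uv}. weight G e)\<rparr>"

text \<open>The ring of integer polynomials in w and r, as polynomials in r over those in w.\<close>

type_synonym wr_poly = "int poly poly"

definition w_var :: wr_poly where "w_var = [:[:0, 1:]:]"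

definition r_var :: wr_poly where "r_var = [:0, 1:]"

definition checkerboard_graph ::
    "('c, 'p) diagram \<Rightarrow> ('c, 'p) dart set set \<Rightarrow>
     (('c, 'p) dart set, 'c, wr_poly) weighted_multigraph" where
  "checkerboard_graph D S =
     \<lparr>verts = S,
      edges = crossings D,
      ends = (\<lambda>c. {R \<in> S. \<exists>l d. (Crossing c l, d) \<in> R}),
      weight = (\<lambda>c. if positive D c then w_var else r_var)\<rparr>"

definition G_B :: "('c, 'p) diagram \<Rightarrow> (('c, 'p) dart set, 'c, wr_poly) weighted_multigraph" where
  "G_B D = checkerboard_graph D (black_regions D)"

definition G_W :: "('c, 'p) diagram \<Rightarrow> (('c, 'p) dart set, 'c, wr_poly) weighted_multigraph" where
  "G_W D = checkerboard_graph D (white_regions D)"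

text \<open>
  An unoriented cycle of length i > 2 of a simple graph is determined by its set of edges.
\<close>

definition closed_path_edges :: "'v list \<Rightarrow> 'v set set" where
  "closed_path_edges vs = {{vs ! j, vs ! (Suc j mod length vs)} | j. j < length vs}"

definition cycles :: "('v, 'a) weighted_graph \<Rightarrow> nat \<Rightarrow> 'v set set set" where
  "cycles G i =
     {C. \<exists>vs. length vs = i \<and> distinct vs \<and> set vs \<subseteq> sverts G \<and>
              C = closed_path_edges vs \<and> C \<subseteq> sedges G}"

text \<open>Only the values at i \<ge> 2 are meaningful.\<close>

definition cycle_poly :: "('v, wr_poly) weighted_graph \<Rightarrow> nat \<Rightarrow> wr_poly" where
  "cycle_poly G i =
     (if i = 2 then \<Sum>e\<in>sedges G. wg G e else \<Sum>C\<in>cycles G i. \<Prod>e\<in>C. wg G e)"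

definition CB :: "nat \<Rightarrow> ('c, 'p) diagram \<Rightarrow> wr_poly" where
  "CB i D = cycle_poly (merge_parallel (G_B D)) i"

definition CW :: "nat \<Rightarrow> ('c, 'p) diagram \<Rightarrow> wr_poly" where
  "CW i D = cycle_poly (merge_parallel (G_W D)) i"

section \<open>Tangles\<close>

text \<open>
  A piece of a diagram in a disk, or in the complement of a disk, whose boundary circle is met in
  four points: top left, top right, bottom left, bottom right. Strands run upwards in the disk.
  As an argument of tnxt, Inr s stands for the end point on side s at which the link enters the
  piece, and as a value for the one at which it leaves the piece. Hence for a tangle in the disk
  arguments Inr s are bottom and values Inr s are top end points; for the exterior of the disk it
  is the other way round.
\<close>

datatype side = Lft | Rgt

record ('c, 'p) tangle =
  tcrossings :: "'c set"
  tpoints :: "'p set"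
  tpositive :: "'c \<Rightarrow> bool"
  tnxt :: "('c, 'p) site + side \<Rightarrow> ('c, 'p) site + side"

text \<open>The four end points become marked points of the glued diagram.\<close>

datatype ('p, 'q) glued_point = Outer 'p | Inner 'q | Top side | Bottom side

fun outer_site ::
    "('c, 'p) site + side \<Rightarrow> ('c + 'd, ('p, 'q) glued_point) site" where
  "outer_site (Inl (Crossing c l)) = Crossing (Inl c) l"
| "outer_site (Inl (Point p)) = Point (Outer p)"
| "outer_site (Inr s) = Point (Bottom s)"

fun inner_site ::
    "('d, 'q) site + side \<Rightarrow> ('c + 'd, ('p, 'q) glued_point) site" where
  "inner_site (Inl (Crossing d l)) = Crossing (Inr d) l"
| "inner_site (Inl (Point q)) = Point (Inner q)"
| "inner_site (Inr s) = Point (Top s)"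

fun glued_nxt ::
    "('c, 'p) tangle \<Rightarrow> ('d, 'q) tangle \<Rightarrow>
     ('c + 'd, ('p, 'q) glued_point) site \<Rightarrow> ('c + 'd, ('p, 'q) glued_point) site" where
  "glued_nxt E T (Crossing (Inl c) l) = outer_site (tnxt E (Inl (Crossing c l)))"
| "glued_nxt E T (Point (Outer p)) = outer_site (tnxt E (Inl (Point p)))"
| "glued_nxt E T (Point (Top s)) = outer_site (tnxt E (Inr s))"
| "glued_nxt E T (Crossing (Inr d) l) = inner_site (tnxt T (Inl (Crossing d l)))"
| "glued_nxt E T (Point (Inner q)) = inner_site (tnxt T (Inl (Point q)))"
| "glued_nxt E T (Point (Bottom s)) = inner_site (tnxt T (Inr s))"

text \<open>
  The diagram that is E outside the disk and T inside. Diagrams with a common first argument are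
  those that are identical outside the disk. The exterior is not required separately to be
  well-formed and planar: this is equivalent to link_diagram holding for the diagram with a single
  crossing in place of the disk.
\<close>

definition glue ::
    "('c, 'p) tangle \<Rightarrow> ('d, 'q) tangle \<Rightarrow> ('c + 'd, ('p, 'q) glued_point) diagram" where
  "glue E T =
     \<lparr>crossings = tcrossings E <+> tcrossings T,
      points = Outer ` tpoints E \<union> Inner ` tpoints T \<union> range Top \<union> range Bottom,
      positive = case_sum (tpositive E) (tpositive T),
      nxt = glued_nxt E T\<rparr>"

definition t_a :: "(nat, unit) tangle" where
  "t_a = \<lparr>tcrossings = {}, tpoints = {}, tpositive = (\<lambda>_. True), tnxt = (\<lambda>x. x)\<rparr>"

text \<open>
  At a crossing of sign sg with upward strands: the level of the strand arriving at the bottom on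
  side s, and the side on which the strand of level l leaves at the top.
\<close>

definition arriving_level :: "bool \<Rightarrow> side \<Rightarrow> level" where
  "arriving_level sg s = (if sg = (s = Lft) then Over else Under)"

definition leaving_side :: "bool \<Rightarrow> level \<Rightarrow> side" where
  "leaving_side sg l = (if sg = (l = Over) then Rgt else Lft)"

text \<open>
  The vertical twist with crossings 0, ..., m - 1 from bottom to top (m > 0), all of sign sg
  (True for positive). The bigons between consecutive crossings are black for positive and
  white for negative sign.
\<close>

fun twist_nxt :: "bool \<Rightarrow> nat \<Rightarrow> (nat, unit) site + side \<Rightarrow> (nat, unit) site + side" where
  "twist_nxt sg m (Inr s) = Inl (Crossing 0 (arriving_level sg s))"
| "twist_nxt sg m (Inl (Crossing i l)) =
     (let s = leaving_side sg l
      in if Suc i < m then Inl (Crossing (Suc i) (arriving_level sg s)) else Inr s)"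
| "twist_nxt sg m (Inl (Point q)) = Inl (Point q)"

definition twist :: "bool \<Rightarrow> nat \<Rightarrow> (nat, unit) tangle" where
  "twist sg m =
     \<lparr>tcrossings = {..<m}, tpoints = {}, tpositive = (\<lambda>_. sg), tnxt = twist_nxt sg m\<rparr>"

definition t_b :: "(nat, unit) tangle" where "t_b = twist True 1"

definition t_c :: "(nat, unit) tangle" where "t_c = twist False 1"

definition Btw :: "nat \<Rightarrow> (nat, unit) tangle" where "Btw m = twist True m"

definition Wtr :: "nat \<Rightarrow> (nat, unit) tangle" where "Wtr m = twist False m"

text \<open>
  The two regions lying to the left and to the right of the tangle. At a marked point, the corner
  starting at Out lies to the left of the strand and the one starting at In to its right.
\<close>

definition left_region ::
    "('c, ('p, 'q) glued_point) diagram \<Rightarrow> ('c, ('p, 'q) glued_point) dart set" where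
  "left_region D = region D (Point (Bottom Lft), Out)"

definition right_region ::
    "('c, ('p, 'q) glued_point) diagram \<Rightarrow> ('c, ('p, 'q) glued_point) dart set" where
  "right_region D = region D (Point (Bottom Rgt), In)"

text \<open>
  The recursions for twists suppose that all crossings between the regions to the left and to the
  right of the tangle lie in the tangle: these regions are joined by one edge for t_b or t_c, and
  by none for t_a. Otherwise the recursions fail: closing up Wtr 5, t_c and t_a with a braid of
  k negative crossings, k > 1, gives cycle polynomials of index 2 equal to r^(k+5), r^(k+1), r^k.
\<close>

definition no_edge_across ::
    "(('c, ('p, 'q) glued_point) dart set, 'e, 'a) weighted_multigraph \<Rightarrow>
     ('c, ('p, 'q) glued_point) diagram \<Rightarrow> bool" where
  "no_edge_across G D \<longleftrightarrow> (\<forall>e\<in>edges G. ends G e \<noteq> {left_region D, right_region D})"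

end

(*
  Call "side regions" the regions of the colour lying to the left and to the right of the twist.
  Each of them passes through the twist only along its left or its right side, so forgetting the
  corners inside the twist maps the side regions of the twisted diagram injectively to regions of
  the diagram with t_a, and this preserves incidence with the outer crossings. All m crossings of
  the twist become parallel edges between the left and the right region. Hence the simple graph of
  the twisted diagram is that of t_a with one new edge of weight x^m, where x is r or w. A cycle
  uses this edge at most once, so its cycle polynomial is P + x^m Q, where P belongs to t_a and Q
  does not depend on m. Comparing m = 2n + 1 with m = 1 gives both recursions.
*)

theory Submission
  imports Defs
begin

section \<open>Regions of alternating diagrams\<close>

text \<open>\<open>orbit f x\<close> starts with \<open>f x\<close>, so that it returns to
  \<open>x\<close> needs finiteness. Extended by the identity outside \<open>A\<close>, the map
  becomes a permutation with the same orbit of \<open>x\<close>.\<close>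

lemma self_in_orbit_finite:
  assumes "finite A" "inj_on f A" "f ` A \<subseteq> A" "x \<in> A"
  shows "x \<in> orbit f x"
proof -
  let ?g = "\<lambda>y. if y \<in> A then f y else y"
  have "bij_betw f A A"
    using assms by (simp add: bij_betw_def endo_inj_surj)
  then have "bij_betw ?g A A"
    by (rule bij_betw_cong[THEN iffD1, rotated]) simp
  then have "?g permutes A"
    by (rule bij_imp_permutes) simp
  then have "x \<in> orbit ?g x"
    using assms(1) by (intro permutation_self_in_orbit) (auto simp: permutation_permutes)
  moreover have "orbit f x = orbit ?g x"
    using assms by (intro orbit_cong0) auto
  ultimately show ?thesis
    by (simp only:)
qed

lemma orbit_eq_of_mem:
  assumes "s \<in> orbit f s" "t \<in> orbit f s"
  shows "orbit f t = orbit f s"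
  using orbit_swap[OF assms] assms by (blast intro: orbit_trans)

abbreviation face_step :: "('c, 'p) diagram \<Rightarrow> ('c, 'p) dart \<Rightarrow> ('c, 'p) dart" where
  "face_step D h \<equiv> twin D (rot D h)"

lemma inj_rot: "inj (rot D)"
proof (rule injI)
  fix x y assume "rot D x = rot D y"
  then show "x = y"
    by (cases "(D, x)" rule: rot.cases; cases "(D, y)" rule: rot.cases;
        auto split: if_splits elim: flip.elims)
qed

context
  fixes D :: "('c, 'p) diagram"
  assumes D: "link_diagram D"
begin

lemma finite_darts: "finite (darts D)"
proof -
  have "UNIV = {In, Out}" "UNIV = {Over, Under}"
    using dir.exhaust level.exhaust by blast+
  then have "finite (UNIV :: dir set)" "finite (UNIV :: level set)"
    by (metis finite.emptyI finite.insertI)+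
  moreover have "sites D = (\<lambda>(c, l). Crossing c l) ` (crossings D \<times> UNIV) \<union> Point ` points D"
    unfolding sites_def by auto
  ultimately show ?thesis
    using D by (simp add: darts_def link_diagram_def)
qed

lemma nxt_bij: "bij_betw (nxt D) (sites D) (sites D)"
  using D by (simp add: link_diagram_def)

lemma nxt_in_sites: "v \<in> sites D \<Longrightarrow> nxt D v \<in> sites D"
  using nxt_bij by (rule bij_betwE[rule_format])

lemma prev_in_sites: "v \<in> sites D \<Longrightarrow> inv_into (sites D) (nxt D) v \<in> sites D"
  using bij_betw_inv_into[OF nxt_bij] by (rule bij_betwE[rule_format])

lemma nxt_prev: "v \<in> sites D \<Longrightarrow> nxt D (inv_into (sites D) (nxt D) v) = v"
  using nxt_bij by (rule bij_betw_inv_into_right)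

lemma prev_eqI: "u \<in> sites D \<Longrightarrow> nxt D u = v \<Longrightarrow> inv_into (sites D) (nxt D) v = u"
  using bij_betw_inv_into_left[OF nxt_bij] by blast

lemma rot_in_darts: "h \<in> darts D \<Longrightarrow> rot D h \<in> darts D"
  by (cases "(D, h)" rule: rot.cases) (auto simp: darts_def sites_def)

lemma twin_in_darts: "h \<in> darts D \<Longrightarrow> twin D h \<in> darts D"
  by (cases "(D, h)" rule: twin.cases) (auto simp: darts_def nxt_in_sites prev_in_sites)

lemma inj_on_twin: "inj_on (twin D) (darts D)"
proof (rule inj_onI)
  have inj: "inj_on (nxt D) (sites D)" "inj_on (inv_into (sites D) (nxt D)) (sites D)"
    using nxt_bij bij_betw_inv_into[OF nxt_bij] by (simp_all add: bij_betw_def)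
  fix x y assume "x \<in> darts D" "y \<in> darts D" "twin D x = twin D y"
  then show "x = y"
    by (cases "(D, x)" rule: twin.cases; cases "(D, y)" rule: twin.cases;
        auto simp: darts_def inj_on_eq_iff[OF inj(1)] inj_on_eq_iff[OF inj(2)])
qed

lemma face_step_in_darts: "h \<in> darts D \<Longrightarrow> face_step D h \<in> darts D"
  by (simp add: rot_in_darts twin_in_darts)

text \<open>A boundary step is injective on the finite set of darts, since \<open>rot\<close> and
  \<open>twin\<close> are, so the boundary walk closes up at its start.\<close>

lemma dart_in_region:
  assumes "h \<in> darts D" shows "h \<in> region D h"
  unfolding region_def
proof (rule self_in_orbit_finite[OF finite_darts _ _ assms])
  have "inj_on (twin D) (rot D ` darts D)"
    using rot_in_darts by (blast intro: inj_on_subset[OF inj_on_twin])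
  then show "inj_on (face_step D) (darts D)"
    using comp_inj_on[OF inj_on_subset[OF inj_rot subset_UNIV]] by (fastforce simp: comp_def)
  show "face_step D ` darts D \<subseteq> darts D"
    using face_step_in_darts by blast
qed

lemma region_eq_of_mem: "h \<in> darts D \<Longrightarrow> x \<in> region D h \<Longrightarrow> region D x = region D h"
  unfolding region_def by (rule orbit_eq_of_mem) (use dart_in_region in \<open>simp_all add: region_def\<close>)

lemma region_face_step: "h \<in> darts D \<Longrightarrow> region D (face_step D h) = region D h"
  unfolding region_def by (rule self_in_orbit_step) (use dart_in_region in \<open>simp add: region_def\<close>)

lemma region_subset_darts:
  assumes "h \<in> darts D" shows "region D h \<subseteq> darts D"
proof
  fix x assume "x \<in> region D h"
  then show "x \<in> darts D"
    unfolding region_def by induction (simp_all add: assms face_step_in_darts)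
qed

lemma region_in_regions: "h \<in> darts D \<Longrightarrow> region D h \<in> regions D"
  by (simp add: regions_def)

lemma region_eq_of_mem_regions: "R \<in> regions D \<Longrightarrow> x \<in> R \<Longrightarrow> x \<in> darts D \<and> R = region D x"
  unfolding regions_def using region_subset_darts region_eq_of_mem by blast

end

section \<open>Arcs through marked points, and the level of a region\<close>

text \<open>The premise of \<open>alternating\<close> without its step count, so that it can be
  carried from one marked point to the next.\<close>

definition arc :: "('c, 'p) diagram \<Rightarrow> ('c, 'p) site \<Rightarrow> ('c, 'p) site \<Rightarrow> bool" where
  "arc D u v \<longleftrightarrow>
     (\<exists>m. (\<forall>j\<in>{1..m}. (nxt D ^^ j) u \<in> range Point) \<and> (nxt D ^^ Suc m) u = v)"

lemma arc_nxt: "arc D u (nxt D u)"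
  unfolding arc_def by (rule exI[of _ 0]) simp

lemma arc_snoc:
  assumes "arc D u (Point p)"
  shows "arc D u (nxt D (Point p))"
proof -
  obtain m where m: "\<forall>j\<in>{1..m}. (nxt D ^^ j) u \<in> range Point" "(nxt D ^^ Suc m) u = Point p"
    using assms unfolding arc_def by blast
  have "(nxt D ^^ j) u \<in> range Point" if "j \<in> {1..Suc m}" for j
    using m that by (cases "j = Suc m") auto
  with m(2) show ?thesis
    unfolding arc_def by (intro exI[of _ "Suc m"]) simp
qed

lemma arc_Cons:
  assumes "nxt D u = Point p" "arc D (Point p) v"
  shows "arc D u v"
proof -
  obtain m where m: "\<forall>j\<in>{1..m}. (nxt D ^^ j) (Point p) \<in> range Point"
      "(nxt D ^^ Suc m) (Point p) = v"
    using assms unfolding arc_def by blast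
  have shift: "(nxt D ^^ Suc j) u = (nxt D ^^ j) (Point p)" for j
    using assms(1) by (simp add: funpow_Suc_right del: funpow.simps)
  have "(nxt D ^^ j) u \<in> range Point" if "j \<in> {1..Suc m}" for j
  proof (cases j)
    case (Suc i)
    then show ?thesis
      \<comment> \<open>For \<open>i = 0\<close> the site is \<open>Point p\<close>, now an interior
        point of the arc.\<close>
      using m assms(1) that unfolding Suc shift by (cases "i = 0") auto
  qed (use that in simp)
  with m(2) show ?thesis
    unfolding arc_def by (intro exI[of _ "Suc m"]) (simp add: shift del: funpow.simps)
qed

lemma alternating_arc:
  "alternating D \<Longrightarrow> c \<in> crossings D \<Longrightarrow> arc D (Crossing c l) (Crossing c' l') \<Longrightarrow> l' \<noteq> l"
  unfolding alternating_def arc_def by blast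

text \<open>
  A region turns at each crossing from one strand to the other, and along the next arc the level
  changes again.
\<close>

lemma region_level:
  assumes "link_diagram D" "alternating D" "c \<in> crossings D"
    and "(Crossing c' l', d') \<in> region D (Crossing c l, d)"
  shows "l' = l"
proof -
  \<comment> \<open>Invariant of the boundary walk. It follows the link from \<open>In\<close> darts
    of marked points and runs against it from \<open>Out\<close> darts. In either case the crossing
    last left was left on the strand of the level other than \<open>l\<close>.\<close>
  define P where "P h \<longleftrightarrow> h \<in> darts D \<and>
    (case h of
       (Crossing c' l', d') \<Rightarrow> l' = l
     | (Point p, In) \<Rightarrow> \<exists>c0\<in>crossings D. \<exists>l0. l0 \<noteq> l \<and> arc D (Crossing c0 l0) (Point p)
     | (Point p, Out) \<Rightarrow> \<exists>c0\<in>crossings D. \<exists>l0. l0 \<noteq> l \<and> arc D (Point p) (Crossing c0 l0))" for h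
  have P_In: "P (v, In)" if "c0 \<in> crossings D" "l0 \<noteq> l" "arc D (Crossing c0 l0) v" "v \<in> sites D"
    for v c0 l0
  proof (cases v)
    case (Crossing c1 l1)
    then have "l1 \<noteq> l0"
      using alternating_arc[OF assms(2)] that by simp
    then have "l1 = l"
      using that(2) by (metis level.exhaust)
    then show ?thesis
      using that Crossing by (simp add: P_def darts_def)
  qed (use that in \<open>auto simp: P_def darts_def\<close>)
  have P_Out: "P (v, Out)" if "c0 \<in> crossings D" "l0 \<noteq> l" "arc D v (Crossing c0 l0)" "v \<in> sites D"
    for v c0 l0
  proof (cases v)
    case (Crossing c1 l1)
    with that have "c1 \<in> crossings D"
      by (auto simp: sites_def)
    then have "l0 \<noteq> l1"
      using alternating_arc[OF assms(2)] that Crossing by simp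
    then have "l1 = l"
      using that(2) by (metis level.exhaust)
    then show ?thesis
      using that Crossing by (simp add: P_def darts_def)
  qed (use that in \<open>auto simp: P_def darts_def\<close>)
  have step: "P (face_step D h)" if P: "P h" for h
  proof -
    obtain v d0 where h: "h = (v, d0)" by force
    have v: "v \<in> sites D"
      using P h by (simp add: P_def darts_def)
    show ?thesis
    proof (cases v)
      case (Crossing c1 l1)
      then have c1: "c1 \<in> crossings D" and l1: "l1 = l"
        using v P h by (auto simp: sites_def P_def)
      \<comment> \<open>Turning at a crossing always changes the level; the direction
        \<open>d2\<close> depends on the sign and on the level, so both are treated.\<close>
      obtain l2 d2 where r: "rot D h = (Crossing c1 l2, d2)" "l2 \<noteq> l"
        unfolding h Crossing l1 by (cases l) auto
      have s: "Crossing c1 l2 \<in> sites D"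
        using c1 by (simp add: sites_def)
      show ?thesis
      proof (cases d2)
        case Out
        then show ?thesis
          using P_In[OF c1 r(2) arc_nxt] nxt_in_sites[OF assms(1) s] r by simp
      next
        case In
        let ?u = "inv_into (sites D) (nxt D) (Crossing c1 l2)"
        have "arc D ?u (Crossing c1 l2)"
          using arc_nxt[of D ?u] nxt_prev[OF assms(1) s] by simp
        then show ?thesis
          using P_Out[OF c1 r(2)] prev_in_sites[OF assms(1) s] r In by simp
      qed
    next
      case (Point p)
      show ?thesis
      proof (cases d0)
        case In
        then obtain c0 l0 where c0: "c0 \<in> crossings D" "l0 \<noteq> l" "arc D (Crossing c0 l0) (Point p)"
          using P h Point by (auto simp: P_def)
        then show ?thesis
          using P_In[OF c0(1,2) arc_snoc[OF c0(3)]] nxt_in_sites[OF assms(1) v] h Point In by simp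
      next
        case Out
        then obtain c0 l0 where c0: "c0 \<in> crossings D" "l0 \<noteq> l" "arc D (Point p) (Crossing c0 l0)"
          using P h Point by (auto simp: P_def)
        let ?u = "inv_into (sites D) (nxt D) (Point p)"
        have "arc D ?u (Crossing c0 l0)"
          using c0(3) nxt_prev[OF assms(1) v] Point by (blast intro: arc_Cons)
        then show ?thesis
          using P_Out[OF c0(1,2)] prev_in_sites[OF assms(1) v] h Point Out by simp
      qed
    qed
  qed
  have "P (Crossing c l, d)"
    using assms(3) by (simp add: P_def darts_def sites_def)
  have "P h" if "h \<in> region D (Crossing c l, d)" for h
    using that unfolding region_def by induction (simp_all add: step \<open>P (Crossing c l, d)\<close>)
  then show ?thesis
    using assms(4) by (force simp: P_def)
qed

section \<open>Colours of regions, and ends of edges\<close>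

text \<open>
  The level of the corners to the left and to the right of a crossing of sign sg with upward
  strands: black regions run along the sides of a negative twist, white ones along those of a
  positive twist.
\<close>

definition side_level :: "bool \<Rightarrow> level" where
  "side_level sg = (if sg then Under else Over)"

definition side_regions :: "bool \<Rightarrow> ('c, 'p) diagram \<Rightarrow> ('c, 'p) dart set set" where
  "side_regions sg D = (if sg then white_regions D else black_regions D)"

abbreviation side_graph ::
    "bool \<Rightarrow> ('c, 'p) diagram \<Rightarrow> (('c, 'p) dart set, 'c, wr_poly) weighted_multigraph" where
  "side_graph sg D \<equiv> checkerboard_graph D (side_regions sg D)"

context
  fixes D :: "('c, 'p) diagram"
  assumes D: "link_diagram D" "alternating D"
begin

text \<open>By \<open>region_level\<close> all crossing corners of a region share one level, so a
  single corner decides its colour.\<close>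

lemma region_in_side_regions_iff:
  assumes "c \<in> crossings D"
  shows "region D (Crossing c l, d) \<in> side_regions sg D \<longleftrightarrow> l = side_level sg"
proof -
  have h: "(Crossing c l, d) \<in> darts D"
    using assms by (simp add: darts_def sites_def)
  have "region D (Crossing c l, d) \<in> black_regions D \<longleftrightarrow> l = Over"
    using dart_in_region[OF D(1) h] region_in_regions[OF D(1) h] region_level[OF D assms]
    unfolding black_regions_def by blast
  then show ?thesis
    using region_in_regions[OF D(1) h] level.exhaust[of l]
    by (auto simp: side_regions_def side_level_def white_regions_def)
qed

text \<open>Of the four corners at \<open>c\<close> exactly those of level
  \<open>side_level sg\<close> lie in regions of the chosen colour. This names the ends by darts,
  which can be traced in both diagrams.\<close>

lemma ends_side_graph:
  assumes "c \<in> crossings D"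
  shows "ends (side_graph sg D) c = (\<lambda>d. region D (Crossing c (side_level sg), d)) ` UNIV"
proof -
  have h: "(Crossing c l, d) \<in> darts D" for l d
    using assms by (simp add: darts_def sites_def)
  have reg: "R \<in> regions D" if "R \<in> side_regions sg D" for R
    using that by (auto simp: side_regions_def white_regions_def black_regions_def split: if_splits)
  show ?thesis
  proof (intro equalityI subsetI)
    fix R assume "R \<in> ends (side_graph sg D) c"
    then obtain l d where R: "R \<in> side_regions sg D" "(Crossing c l, d) \<in> R"
      by (auto simp: checkerboard_graph_def)
    then have "R = region D (Crossing c l, d)"
      using region_eq_of_mem_regions[OF D(1)] reg by blast
    with R(1) show "R \<in> (\<lambda>d. region D (Crossing c (side_level sg), d)) ` UNIV"
      by (simp add: region_in_side_regions_iff[OF assms])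
  next
    fix R assume "R \<in> (\<lambda>d. region D (Crossing c (side_level sg), d)) ` UNIV"
    then obtain d where "R = region D (Crossing c (side_level sg), d)"
      by blast
    then show "R \<in> ends (side_graph sg D) c"
      using dart_in_region[OF D(1) h] region_in_side_regions_iff[OF assms]
      by (auto simp: checkerboard_graph_def)
  qed
qed

end

section \<open>Cycle polynomials\<close>

lemma Union_closed_path_edges:
  assumes "length vs \<ge> 2" shows "\<Union> (closed_path_edges vs) = set vs"
proof
  have "Suc j mod length vs < length vs" for j
    using assms by (intro mod_less_divisor) linarith
  then show "\<Union> (closed_path_edges vs) \<subseteq> set vs"
    by (auto simp: closed_path_edges_def)
  show "set vs \<subseteq> \<Union> (closed_path_edges vs)"
  proof
    fix v assume "v \<in> set vs"
    then obtain j where "j < length vs" "v = vs ! j"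
      by (auto simp: in_set_conv_nth)
    then have "{v, vs ! (Suc j mod length vs)} \<in> closed_path_edges vs"
      by (auto simp: closed_path_edges_def)
    then show "v \<in> \<Union> (closed_path_edges vs)"
      by blast
  qed
qed

lemma closed_path_edges_map:
  "closed_path_edges (map f vs) = image f ` closed_path_edges vs"
proof -
  have edge: "{map f vs ! j, map f vs ! (Suc j mod length vs)} =
      f ` {vs ! j, vs ! (Suc j mod length vs)}" if "j < length vs" for j
  proof -
    have "Suc j mod length vs < length vs"
      using that by (intro mod_less_divisor) linarith
    with that show ?thesis
      by simp
  qed
  show ?thesis
    unfolding closed_path_edges_def by (simp add: setcompr_eq_image image_image edge cong: image_cong_simp del: nth_map)
qed

text \<open>The vertices of a closed path are the union of its edges, so an inclusion of edges
  bounds them. Cycles can then be compared between graphs with different vertex sets.\<close>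

lemma cycles_eq:
  assumes "i \<ge> 2" "\<Union> (sedges G) \<subseteq> sverts G"
  shows "cycles G i = {C. \<exists>vs. length vs = i \<and> distinct vs \<and> C = closed_path_edges vs \<and> C \<subseteq> sedges G}"
proof -
  have "set vs \<subseteq> sverts G" if "length vs = i" "closed_path_edges vs \<subseteq> sedges G" for vs
    using Union_closed_path_edges[of vs] Union_mono[OF that(2)] that(1) assms by simp
  then show ?thesis
    unfolding cycles_def by blast
qed

text \<open>A closed path only visits vertices that carry edges, where \<open>f\<close> is
  injective. Hence vertex lists can be pushed forward by \<open>f\<close> and pulled back by its
  inverse without losing distinctness.\<close>

lemma cycles_image:
  assumes "i \<ge> 2" "\<Union> (sedges G) \<subseteq> sverts G" "\<Union> (sedges H) \<subseteq> sverts H"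
    and inj: "inj_on f (\<Union> (sedges G))" and H: "sedges H = image f ` sedges G"
  shows "cycles H i = image (image f) ` cycles G i"
proof
  show "image (image f) ` cycles G i \<subseteq> cycles H i"
  proof
    fix C assume "C \<in> image (image f) ` cycles G i"
    then obtain vs where vs: "length vs = i" "distinct vs" "closed_path_edges vs \<subseteq> sedges G"
      and C: "C = image f ` closed_path_edges vs"
      unfolding cycles_eq[OF assms(1,2)] by blast
    have "set vs \<subseteq> \<Union> (sedges G)"
      using vs Union_closed_path_edges[of vs] assms(1) by blast
    with inj vs have "distinct (map f vs)"
      by (simp add: distinct_map inj_on_subset)
    moreover have "image f ` closed_path_edges vs \<subseteq> sedges H"
      using vs H by blast
    ultimately show "C \<in> cycles H i"
      using vs(1) unfolding C cycles_eq[OF assms(1,3)] closed_path_edges_map[symmetric]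
      by (auto intro!: exI[of _ "map f vs"])
  qed
  show "cycles H i \<subseteq> image (image f) ` cycles G i"
  proof
    fix C assume "C \<in> cycles H i"
    then obtain vs where vs: "length vs = i" "distinct vs" "closed_path_edges vs \<subseteq> sedges H"
      and C: "C = closed_path_edges vs"
      unfolding cycles_eq[OF assms(1,3)] by blast
    let ?g = "inv_into (\<Union> (sedges G)) f"
    have verts: "set vs \<subseteq> f ` \<Union> (sedges G)"
      using Union_closed_path_edges[of vs] Union_mono[OF vs(3)] vs(1) assms(1)
      by (simp add: H image_Union)
    have "f (?g v) = v" if "v \<in> set vs" for v
      using verts that by (intro f_inv_into_f) (rule subsetD)
    then have map: "map f (map ?g vs) = vs"
      by (simp add: map_idI)
    have C': "C = image f ` closed_path_edges (map ?g vs)"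
      unfolding C closed_path_edges_map[symmetric] map ..
    have "distinct (map ?g vs)"
      using vs verts by (simp add: distinct_map inj_on_inv_into)
    moreover have "closed_path_edges (map ?g vs) \<subseteq> sedges G"
    proof
      fix e assume e: "e \<in> closed_path_edges (map ?g vs)"
      have "\<Union> (closed_path_edges (map ?g vs)) = ?g ` set vs"
        using Union_closed_path_edges[of "map ?g vs"] vs assms(1) by simp
      also have "\<dots> \<subseteq> \<Union> (sedges G)"
      proof
        fix v assume "v \<in> ?g ` set vs"
        then obtain u where u: "u \<in> set vs" "v = ?g u"
          by blast
        show "v \<in> \<Union> (sedges G)"
          unfolding u(2) using verts u(1) by (intro inv_into_into) (rule subsetD)
      qed
      finally have "e \<subseteq> \<Union> (sedges G)"
        using e by blast
      moreover have "f ` e \<in> image f ` sedges G"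
        using e vs(3) unfolding C[symmetric] C' H by fast
      then obtain e' where "e' \<in> sedges G" "f ` e = f ` e'"
        by fast
      ultimately show "e \<in> sedges G"
        using inj_on_image_eq_iff[OF inj, of e e'] by fast
    qed
    ultimately have "closed_path_edges (map ?g vs) \<in> cycles G i"
      using vs(1) assms(1,2) by (auto simp: cycles_eq intro!: exI[of _ "map ?g vs"])
    then show "C \<in> image (image f) ` cycles G i"
      unfolding C' by (rule imageI)
  qed
qed

text \<open>Cycle polynomials are invariant under weighted isomorphism: \<open>image f\<close>
  reindexes the edges, and \<open>image (image f)\<close> the cycles.\<close>

lemma cycle_poly_image:
  assumes "i \<ge> 2" "\<Union> (sedges G) \<subseteq> sverts G" "\<Union> (sedges H) \<subseteq> sverts H"
    and "inj_on f (\<Union> (sedges G))" and H: "sedges H = image f ` sedges G"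
    and wg: "\<And>e. e \<in> sedges G \<Longrightarrow> wg H (f ` e) = wg G e"
  shows "cycle_poly H i = cycle_poly G i"
proof -
  have inj: "inj_on (image f) (sedges G)"
    using assms(4) by (auto simp: inj_on_def inj_on_image_eq_iff[OF assms(4)] Union_upper)
  have sub: "C \<subseteq> sedges G" if "C \<in> cycles G i" for C
    using that by (auto simp: cycles_def)
  have "inj_on (image (image f)) (cycles G i)"
    using inj_on_image_eq_iff[OF inj] sub by (intro inj_onI) simp
  then have "(\<Sum>C\<in>cycles H i. prod (wg H) C) = (\<Sum>C\<in>cycles G i. prod (wg H) (image f ` C))"
    unfolding cycles_image[OF assms(1-5)] by (simp add: sum.reindex)
  also have "\<dots> = (\<Sum>C\<in>cycles G i. prod (wg G) C)"
  proof (rule sum.cong[OF refl])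
    fix C assume "C \<in> cycles G i"
    then have "C \<subseteq> sedges G"
      by (rule sub)
    then show "prod (wg H) (image f ` C) = prod (wg G) C"
      using wg by (simp add: prod.reindex[OF inj_on_subset[OF inj]] subset_iff)
  qed
  moreover have "sum (wg H) (sedges H) = sum (wg G) (sedges G)"
    using wg by (simp add: H sum.reindex[OF inj])
  ultimately show ?thesis
    by (simp add: cycle_poly_def)
qed

text \<open>A cycle is a set of edges and contains \<open>e\<close> at most once. One
  \<open>Q\<close> serves all weights \<open>x\<close>, which later makes it independent of the
  length of the twist. With \<open>sverts = UNIV\<close> the ends of \<open>e\<close> need no
  check.\<close>

lemma cycle_poly_affine_in_weight:
  assumes "i \<ge> 2" "finite (sedges G)" "\<Union> (sedges G) \<subseteq> sverts G" "e \<notin> sedges G"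
  shows "\<exists>Q. \<forall>x. cycle_poly
    \<lparr>sverts = UNIV, sedges = insert e (sedges G), wg = (wg G)(e := x)\<rparr> i = cycle_poly G i + x * Q"
proof -
  let ?K = "\<lambda>x. \<lparr>sverts = UNIV, sedges = insert e (sedges G), wg = (wg G)(e := x)\<rparr>"
  \<comment> \<open>The weight 0 is arbitrary, as cycles do not depend on weights.\<close>
  define A where "A = cycles (?K 0) i"
  have A: "cycles (?K x) i = A" for x
    by (simp add: A_def cycles_def)
  have "A \<subseteq> Pow (insert e (sedges G))"
    by (auto simp: A_def cycles_def)
  with assms(2) have fin: "finite A" "\<And>C. C \<in> A \<Longrightarrow> finite C"
    by (auto intro: finite_subset)
  have old: "cycles G i = {C \<in> A. e \<notin> C}"
    using assms(4) by (auto simp: A_def cycles_eq[OF assms(1)] cycles_eq[OF assms(1,3)])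
  \<comment> \<open>For \<open>i = 2\<close> the polynomial is the sum of edge weights, so the new
    edge contributes \<open>x\<close> itself.\<close>
  define Q where "Q = (if i = 2 then 1 else \<Sum>C\<in>{C \<in> A. e \<in> C}. prod (wg G) (C - {e}))"
  have "cycle_poly (?K x) i = cycle_poly G i + x * Q" for x
  proof (cases "i = 2")
    case True
    have "sum ((wg G)(e := x)) (sedges G) = sum (wg G) (sedges G)"
      using assms(4) by (intro sum.cong) auto
    with True show ?thesis
      using assms(2,4) by (simp add: cycle_poly_def Q_def)
  next
    case False
    let ?w = "(wg G)(e := x)"
    have "cycle_poly (?K x) i = (\<Sum>C\<in>{C \<in> A. e \<notin> C} \<union> {C \<in> A. e \<in> C}. prod ?w C)"
      using False by (simp add: cycle_poly_def A flip: Collect_disj_eq) (rule sum.cong; auto)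
    also have "\<dots> = (\<Sum>C\<in>{C \<in> A. e \<notin> C}. prod ?w C) + (\<Sum>C\<in>{C \<in> A. e \<in> C}. prod ?w C)"
      using fin(1) by (intro sum.union_disjoint) auto
    also have "(\<Sum>C\<in>{C \<in> A. e \<notin> C}. prod ?w C) = (\<Sum>C\<in>{C \<in> A. e \<notin> C}. prod (wg G) C)"
      by (intro sum.cong prod.cong) auto
    also have "(\<Sum>C\<in>{C \<in> A. e \<in> C}. prod ?w C) =
        (\<Sum>C\<in>{C \<in> A. e \<in> C}. x * prod (wg G) (C - {e}))"
    proof (rule sum.cong[OF refl])
      fix C assume "C \<in> {C \<in> A. e \<in> C}"
      then have "prod ?w C = ?w e * prod ?w (C - {e})"
        using fin(2) by (intro prod.remove) auto
      also have "prod ?w (C - {e}) = prod (wg G) (C - {e})"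
        by (intro prod.cong) auto
      finally show "prod ?w C = x * prod (wg G) (C - {e})"
        by simp
    qed
    finally have "cycle_poly (?K x) i = (\<Sum>C\<in>{C \<in> A. e \<notin> C}. prod (wg G) C) +
        (\<Sum>C\<in>{C \<in> A. e \<in> C}. x * prod (wg G) (C - {e}))" .
    then show ?thesis
      using False by (simp only: cycle_poly_def[of G] Q_def old sum_distrib_left if_False)
  qed
  then show ?thesis
    by blast
qed

section \<open>Inserting a twist\<close>

text \<open>\<open>m_pos\<close> matters: \<open>twist_nxt\<close> sends the bottom end points to
  crossing 0, which must exist.\<close>

locale twist_insertion =
  fixes E :: "('c, 'p) tangle" and sg :: bool and m :: nat
  assumes m_pos: "0 < m"
    and X_link: "link_diagram (glue E (twist sg m))"
    and X_alt: "alternating (glue E (twist sg m))"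
    and Z_link: "link_diagram (glue E t_a)"
    and Z_alt: "alternating (glue E t_a)"
begin

abbreviation X :: "('c + nat, ('p, unit) glued_point) diagram" where
  "X \<equiv> glue E (twist sg m)"

abbreviation Z :: "('c + nat, ('p, unit) glued_point) diagram" where
  "Z \<equiv> glue E t_a"

abbreviation "lv \<equiv> side_level sg"

text \<open>For either sign the strand of level \<open>lv\<close> leaves at the top left and arrives
  at the bottom right. Counterclockwise turns from these two darts sweep out the left and the right
  corner.\<close>

abbreviation left_corner :: "nat \<Rightarrow> ('c + nat, ('p, unit) glued_point) dart" where
  "left_corner i \<equiv> (Crossing (Inr i) lv, Out)"

abbreviation right_corner :: "nat \<Rightarrow> ('c + nat, ('p, unit) glued_point) dart" where
  "right_corner i \<equiv> (Crossing (Inr i) lv, In)"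

section \<open>The two diagrams outside the disk\<close>

lemma crossings_X: "crossings X = crossings Z \<union> Inr ` {..<m}"
  by (auto simp: glue_def twist_def t_a_def)

lemma crossings_Z: "crossings Z = Inl ` tcrossings E"
  by (auto simp: glue_def t_a_def)

text \<open>\<open>t_a\<close> has no sites of its own, and both gluings use the same type, so
  regions of \<open>Z\<close> and \<open>X\<close> can be compared as sets of darts.\<close>

lemma sites_Z_subset: "sites Z \<subseteq> sites X"
  by (auto simp: glue_def twist_def t_a_def sites_def)

lemma darts_Z_subset: "darts Z \<subseteq> darts X"
  using sites_Z_subset by (auto simp: darts_def)

lemma Inr_not_in_sites_Z: "Crossing (Inr i) l \<notin> sites Z"
  by (auto simp: sites_def crossings_Z)

lemma end_point_in_sites_Z: "Point (Top s) \<in> sites Z" "Point (Bottom s) \<in> sites Z"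
  by (auto simp: glue_def sites_def)

lemmas end_point_in_sites_X = end_point_in_sites_Z[THEN subsetD[OF sites_Z_subset]]

lemma inner_in_sites_X: "i < m \<Longrightarrow> Crossing (Inr i) l \<in> sites X"
  by (simp add: sites_def crossings_X)

lemma corner_in_darts: "i < m \<Longrightarrow> (Crossing (Inr i) l, d) \<in> darts X"
  by (simp add: darts_def inner_in_sites_X)

lemma nxt_Z_Bottom: "nxt Z (Point (Bottom s)) = Point (Top s)"
  by (simp add: glue_def t_a_def)

lemma nxt_X_Bottom: "nxt X (Point (Bottom s)) = Crossing (Inr 0) (arriving_level sg s)"
  by (simp add: glue_def twist_def)

lemma nxt_X_inner:
  "nxt X (Crossing (Inr i) l) =
     (if Suc i < m then Crossing (Inr (Suc i)) (arriving_level sg (leaving_side sg l))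
      else Point (Top (leaving_side sg l)))"
  by (simp add: glue_def twist_def Let_def)

lemma nxt_X_outer:
  assumes "v \<in> sites Z" "\<And>s. v \<noteq> Point (Bottom s)"
  shows "nxt X v = nxt Z v"
  using assms by (auto simp: glue_def t_a_def sites_def)

text \<open>In \<open>Z\<close> a bottom end point is followed by a top one, so the predecessor of
  any other site is one where both successor maps agree.\<close>

lemma prev_X_outer:
  assumes "v \<in> sites Z" "\<And>s. v \<noteq> Point (Top s)"
  shows "inv_into (sites X) (nxt X) v = inv_into (sites Z) (nxt Z) v"
proof -
  let ?u = "inv_into (sites Z) (nxt Z) v"
  have u: "?u \<in> sites Z" "nxt Z ?u = v"
    using prev_in_sites[OF Z_link assms(1)] nxt_prev[OF Z_link assms(1)] .
  then have "?u \<noteq> Point (Bottom s)" for s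
    using assms(2)[of s] nxt_Z_Bottom[of s] by metis
  then show ?thesis
    using u nxt_X_outer[OF u(1)] sites_Z_subset by (intro prev_eqI[OF X_link]) auto
qed

lemma rot_eq: "h \<in> darts Z \<Longrightarrow> rot X h = rot Z h"
  by (cases "(X, h)" rule: rot.cases) (auto simp: darts_def sites_def glue_def t_a_def)

text \<open>The excluded darts are those whose step enters the disk: down from a top end point, or
  up from a bottom one.\<close>

lemma face_step_outer:
  assumes h: "h \<in> darts Z"
    and "\<And>s. h \<noteq> (Point (Top s), Out)" "\<And>s. h \<noteq> (Point (Bottom s), In)"
  shows "face_step X h = face_step Z h"
proof -
  obtain v d where r: "rot Z h = (v, d)"
    by force
  then have v: "v \<in> sites Z"
    using rot_in_darts[OF Z_link h] by (simp add: darts_def)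
  have "v \<noteq> Point (Top s)" if "d = In" for s
    using that r assms(2)[of s] by (cases "(Z, h)" rule: rot.cases) (auto elim: flip.elims)
  moreover have "v \<noteq> Point (Bottom s)" if "d = Out" for s
    using that r assms(3)[of s] by (cases "(Z, h)" rule: rot.cases) (auto elim: flip.elims)
  ultimately show ?thesis
    unfolding rot_eq[OF h] r using nxt_X_outer[OF v] prev_X_outer[OF v] by (cases d) auto
qed

section \<open>Boundary steps through the disk\<close>

lemma face_step_Z_Top_Lft: "face_step Z (Point (Top Lft), Out) = (Point (Bottom Lft), Out)"
  using prev_eqI[OF Z_link end_point_in_sites_Z(2) nxt_Z_Bottom] by simp

lemma face_step_Z_Bottom_Rgt: "face_step Z (Point (Bottom Rgt), In) = (Point (Top Rgt), In)"
  by (simp add: nxt_Z_Bottom)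

lemma prev_X_inner:
  assumes "i < m" "nxt X (Crossing (Inr i) l) = v"
  shows "inv_into (sites X) (nxt X) v = Crossing (Inr i) l"
  using prev_eqI[OF X_link inner_in_sites_X] assms by blast

lemma face_step_X_Top_Lft: "face_step X (Point (Top Lft), Out) = left_corner (m - 1)"
proof -
  have "nxt X (Crossing (Inr (m - 1)) lv) = Point (Top Lft)"
    using m_pos by (simp add: nxt_X_inner leaving_side_def side_level_def)
  then show ?thesis
    using prev_X_inner m_pos by simp
qed

text \<open>This dart borders the region above the twist, of the other colour. Together with its
  counterpart below the twist, it is thereby kept out of the side regions.\<close>

lemma face_step_X_Top_Rgt:
  "\<exists>l. l \<noteq> lv \<and> face_step X (Point (Top Rgt), Out) = (Crossing (Inr (m - 1)) l, Out)"
proof -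
  let ?l = "side_level (\<not> sg)"
  have "nxt X (Crossing (Inr (m - 1)) ?l) = Point (Top Rgt)"
    using m_pos by (simp add: nxt_X_inner leaving_side_def side_level_def)
  then show ?thesis
    using prev_X_inner m_pos by (intro exI[of _ ?l]) (simp add: side_level_def)
qed

lemma face_step_X_Bottom_Lft:
  "\<exists>l. l \<noteq> lv \<and> face_step X (Point (Bottom Lft), In) = (Crossing (Inr 0) l, In)"
  by (auto simp: nxt_X_Bottom arriving_level_def side_level_def)

lemma face_step_X_Bottom_Rgt: "face_step X (Point (Bottom Rgt), In) = right_corner 0"
  by (auto simp: nxt_X_Bottom arriving_level_def side_level_def)

text \<open>The boundary walk of the left region descends the twist to the bottom left end point;
  that of the right region ascends to the top right one.\<close>

lemma face_step_left_corner:
  assumes "i < m"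
  shows "face_step X (left_corner i) =
    (case i of 0 \<Rightarrow> (Point (Bottom Lft), Out) | Suc j \<Rightarrow> left_corner j)"
proof -
  let ?l = "side_level (\<not> sg)"
  have r: "rot X (left_corner i) = (Crossing (Inr i) ?l, In)"
    by (simp add: side_level_def glue_def twist_def)
  show ?thesis
  proof (cases i)
    case 0
    have "nxt X (Point (Bottom Lft)) = Crossing (Inr i) ?l"
      by (simp add: 0 nxt_X_Bottom arriving_level_def side_level_def)
    then have "inv_into (sites X) (nxt X) (Crossing (Inr i) ?l) = Point (Bottom Lft)"
      by (rule prev_eqI[OF X_link end_point_in_sites_X(2)])
    then show ?thesis
      using r by (simp add: 0)
  next
    case (Suc j)
    then have "nxt X (Crossing (Inr j) lv) = Crossing (Inr i) ?l"
      using assms by (simp add: nxt_X_inner leaving_side_def arriving_level_def side_level_def)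
    then have "inv_into (sites X) (nxt X) (Crossing (Inr i) ?l) = Crossing (Inr j) lv"
      using assms Suc by (intro prev_X_inner) simp_all
    then show ?thesis
      using r by (simp add: Suc)
  qed
qed

lemma face_step_right_corner:
  "face_step X (right_corner i) =
    (if Suc i < m then right_corner (Suc i) else (Point (Top Rgt), In))"
proof -
  have "rot X (right_corner i) = (Crossing (Inr i) (side_level (\<not> sg)), Out)"
    by (simp add: side_level_def glue_def twist_def)
  then show ?thesis
    by (simp add: nxt_X_inner leaving_side_def arriving_level_def side_level_def)
qed

lemma region_left_corner: "i < m \<Longrightarrow> region X (left_corner i) = region X (Point (Bottom Lft), Out)"
proof (induction i)
  case 0
  then show ?case
    using region_face_step[OF X_link corner_in_darts[of 0 lv Out]] face_step_left_corner[of 0] by simp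
next
  case (Suc i)
  then show ?case
    using region_face_step[OF X_link corner_in_darts[of "Suc i" lv Out]]
      face_step_left_corner[of "Suc i"] by simp
qed

lemma region_right_corner: "i < m \<Longrightarrow> region X (right_corner i) = region X (Point (Bottom Rgt), In)"
proof (induction i)
  case 0
  have "(Point (Bottom Rgt), In) \<in> darts X"
    by (simp add: darts_def end_point_in_sites_X)
  then show ?case
    using region_face_step[OF X_link] face_step_X_Bottom_Rgt by metis
next
  case (Suc i)
  then show ?case
    using region_face_step[OF X_link corner_in_darts[of i lv In]]
      face_step_right_corner[of i] by simp
qed

section \<open>Side regions of the two diagrams\<close>

text \<open>The darts outside the twist whose regions have the colour of the sides of the twist.\<close>

definition side_darts :: "('c + nat, ('p, unit) glued_point) dart set" where
  "side_darts = {h \<in> darts Z. \<exists>c d. (Crossing c lv, d) \<in> region X h}"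

lemma side_darts_in_darts:
  assumes "h \<in> side_darts" shows "h \<in> darts Z" "h \<in> darts X"
  using assms darts_Z_subset by (auto simp: side_darts_def)

lemma side_darts_crossing:
  assumes "h \<in> side_darts" "(Crossing c l, d) \<in> region X h"
  shows "l = lv"
proof -
  have h: "h \<in> darts X"
    using side_darts_in_darts assms by blast
  obtain c' d' where c': "(Crossing c' lv, d') \<in> region X h"
    using assms by (auto simp: side_darts_def)
  then have "c' \<in> crossings X"
    using region_subset_darts[OF X_link h] by (auto simp: darts_def sites_def)
  moreover have "(Crossing c l, d) \<in> region X (Crossing c' lv, d')"
    using region_eq_of_mem[OF X_link h c'] assms(2) by simp
  ultimately show ?thesis
    by (rule region_level[OF X_link X_alt])
qed

text \<open>Of the four steps into the disk, those from the top right and the bottom left reach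
  corners of the wrong level, so only the walks down the left and up the right side remain.\<close>

lemma face_step_side_darts:
  assumes "h \<in> side_darts"
  shows "h = (Point (Top Lft), Out) \<or> h = (Point (Bottom Rgt), In) \<or> face_step X h = face_step Z h"
proof -
  have h: "h \<in> darts Z" "h \<in> darts X"
    using side_darts_in_darts[OF assms] by blast+
  have "face_step X h \<in> region X h"
    unfolding region_def by (rule orbit.base)
  then have other: "h \<noteq> (Point (Top Rgt), Out)" "h \<noteq> (Point (Bottom Lft), In)"
    using face_step_X_Top_Rgt face_step_X_Bottom_Lft side_darts_crossing[OF assms] by metis+
  show ?thesis
  proof (cases "h = (Point (Top Lft), Out) \<or> h = (Point (Bottom Rgt), In)")
    case False
    with other have "h \<noteq> (Point (Top s), Out)" "h \<noteq> (Point (Bottom s), In)" for s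
      by (cases s; simp)+
    then show ?thesis
      using face_step_outer[OF h(1)] by blast
  qed blast
qed

lemma side_darts_mono:
  assumes "h \<in> side_darts" "h' \<in> darts Z" "region X h' = region X h"
  shows "h' \<in> side_darts"
  using assms by (simp add: side_darts_def)

text \<open>Where the steps differ, the walk in \<open>X\<close> along one side of the twist stays
  in its region and emerges at the dart that \<open>Z\<close> reaches in one step.\<close>

lemma side_darts_closed:
  assumes "h \<in> side_darts"
  shows "face_step Z h \<in> side_darts" "region X (face_step Z h) = region X h"
proof -
  note h = side_darts_in_darts[OF assms]
  have in_Z: "face_step Z h \<in> darts Z"
    by (rule face_step_in_darts[OF Z_link h(1)])
  show "region X (face_step Z h) = region X h"
    using face_step_side_darts[OF assms]
  proof (elim disjE)
    assume "h = (Point (Top Lft), Out)"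
    then show ?thesis
      using region_face_step[OF X_link h(2)] region_left_corner[of "m - 1"] m_pos
      by (simp only: face_step_Z_Top_Lft face_step_X_Top_Lft)
  next
    assume "h = (Point (Bottom Rgt), In)"
    moreover have "face_step X (right_corner (m - 1)) = (Point (Top Rgt), In)"
      using m_pos by (simp only: face_step_right_corner) simp
    ultimately show ?thesis
      using region_face_step[OF X_link corner_in_darts[of "m - 1" lv In]]
        region_right_corner[of "m - 1"] m_pos
      by (simp only: face_step_Z_Bottom_Rgt diff_less zero_less_one)
  next
    assume "face_step X h = face_step Z h"
    then show ?thesis
      using region_face_step[OF X_link h(2)] by simp
  qed
  then show "face_step Z h \<in> side_darts"
    by (rule side_darts_mono[OF assms in_Z])
qed

lemma region_Z_side_darts:
  assumes "h \<in> side_darts" "x \<in> region Z h"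
  shows "x \<in> side_darts" "region X x = region X h"
proof -
  have "x \<in> side_darts \<and> region X x = region X h"
    using assms(2) unfolding region_def[of Z]
    by induction (simp_all add: assms(1) side_darts_closed)
  then show "x \<in> side_darts" "region X x = region X h"
    by blast+
qed

text \<open>
  A side region of X passes through the twist only along its left or its right side, which Z
  replaces by a single step of the boundary.
\<close>

lemma region_Z_eq:
  assumes "h \<in> side_darts"
  shows "region Z h = region X h \<inter> darts Z"
proof
  show "region Z h \<subseteq> region X h \<inter> darts Z"
    using region_Z_side_darts[OF assms] side_darts_in_darts dart_in_region[OF X_link] by blast
  \<comment> \<open>Invariant of the walk in \<open>X\<close>: while it is on a side of the twist,
    the dart at which it will emerge is already known to lie in \<open>region Z h\<close>.\<close>
  define I where "I y \<longleftrightarrow> y \<in> region Z h \<or>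
    (\<exists>i<m. y = left_corner i \<and> (Point (Bottom Lft), Out) \<in> region Z h) \<or>
    (\<exists>i<m. y = right_corner i \<and> (Point (Top Rgt), In) \<in> region Z h)" for y
  have step: "I (face_step X y)" if "I y" for y
    using that unfolding I_def[of y]
  proof (elim disjE exE conjE)
    assume y: "y \<in> region Z h"
    then have next_y: "face_step Z y \<in> region Z h"
      unfolding region_def by (rule orbit.step)
    show ?thesis
      using face_step_side_darts[OF region_Z_side_darts(1)[OF assms y]]
    proof (elim disjE)
      assume "y = (Point (Top Lft), Out)"
      then show ?thesis
        using next_y m_pos unfolding I_def
        by (simp only: face_step_Z_Top_Lft face_step_X_Top_Lft) auto
    next
      assume "y = (Point (Bottom Rgt), In)"
      then show ?thesis
        using next_y m_pos unfolding I_def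
        by (simp only: face_step_Z_Bottom_Rgt face_step_X_Bottom_Rgt) auto
    qed (simp add: I_def next_y)
  next
    fix i assume "i < m" "y = left_corner i" "(Point (Bottom Lft), Out) \<in> region Z h"
    then show ?thesis
      unfolding I_def by (cases i) (simp_all only: face_step_left_corner nat.case, auto)
  next
    fix i assume "i < m" "y = right_corner i" "(Point (Top Rgt), In) \<in> region Z h"
    then show ?thesis
      unfolding I_def by (simp only: face_step_right_corner) auto
  qed
  have "I h"
    using dart_in_region[OF Z_link] side_darts_in_darts[OF assms] by (simp add: I_def)
  have "I y" if "y \<in> region X h" for y
    using that unfolding region_def by induction (simp_all add: step \<open>I h\<close>)
  \<comment> \<open>Corners in the twist are not darts of \<open>Z\<close>, so only the first
    alternative of \<open>I\<close> survives.\<close>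
  moreover have "y \<in> region Z h" if "I y" "y \<in> darts Z" for y
    using that Inr_not_in_sites_Z by (auto simp: I_def darts_def)
  ultimately show "region X h \<inter> darts Z \<subseteq> region Z h"
    by blast
qed

abbreviation restrict_region ::
    "('c + nat, ('p, unit) glued_point) dart set \<Rightarrow> ('c + nat, ('p, unit) glued_point) dart set" where
  "restrict_region R \<equiv> R \<inter> darts Z"

text \<open>Each of these regions contains a dart of \<open>Z\<close>, and regions sharing a dart
  coincide.\<close>

lemma inj_on_restrict_region: "inj_on restrict_region (region X ` side_darts)"
proof (rule inj_onI, elim imageE)
  fix R R' h h' assume h: "h \<in> side_darts" "h' \<in> side_darts" "R = region X h" "R' = region X h'"
    and eq: "restrict_region R = restrict_region R'"
  have "h \<in> restrict_region R"
    using h side_darts_in_darts dart_in_region[OF X_link] by blast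
  then have "h \<in> region X h'"
    using eq h(4) by blast
  then show "R = R'"
    using h region_eq_of_mem[OF X_link side_darts_in_darts(2)[OF h(2)]] by simp
qed

lemma outer_corner_in_side_darts:
  assumes "c \<in> crossings Z" shows "(Crossing c lv, d) \<in> side_darts"
proof -
  have "(Crossing c lv, d) \<in> darts Z"
    using assms by (simp add: darts_def sites_def)
  then show ?thesis
    using dart_in_region[OF X_link, of "(Crossing c lv, d)"] darts_Z_subset
    by (auto simp: side_darts_def)
qed

lemma end_points_in_side_darts:
  "(Point (Bottom Lft), Out) \<in> side_darts" "(Point (Bottom Rgt), In) \<in> side_darts"
proof -
  have "left_corner 0 \<in> region X (Point (Bottom Lft), Out)"
    "right_corner 0 \<in> region X (Point (Bottom Rgt), In)"
    using dart_in_region[OF X_link corner_in_darts[of 0]] m_pos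
      region_left_corner[of 0] region_right_corner[of 0] by metis+
  then show "(Point (Bottom Lft), Out) \<in> side_darts" "(Point (Bottom Rgt), In) \<in> side_darts"
    by (auto simp: side_darts_def darts_def end_point_in_sites_Z)
qed

section \<open>Comparison of the weighted graphs\<close>

abbreviation "G_X \<equiv> side_graph sg X"
abbreviation "G_Z \<equiv> side_graph sg Z"
abbreviation "across \<equiv> {left_region Z, right_region Z}"

lemma ends_G_X_outer:
  assumes "c \<in> crossings Z"
  shows "ends G_X c \<subseteq> region X ` side_darts" "restrict_region ` ends G_X c = ends G_Z c"
proof -
  have X: "ends G_X c = (\<lambda>d. region X (Crossing c lv, d)) ` UNIV"
    by (rule ends_side_graph[OF X_link X_alt]) (use assms crossings_X in blast)
  show "ends G_X c \<subseteq> region X ` side_darts"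
    unfolding X using outer_corner_in_side_darts[OF assms] by blast
  show "restrict_region ` ends G_X c = ends G_Z c"
    unfolding X ends_side_graph[OF Z_link Z_alt assms] image_image
    using region_Z_eq[OF outer_corner_in_side_darts[OF assms]] by simp
qed

text \<open>The corners of every twist crossing lie in the regions of the same two bottom darts.
  These darts belong to \<open>Z\<close> as well and generate its left and right region.\<close>

lemma ends_G_X_inner:
  assumes "i < m"
  shows "ends G_X (Inr i) \<subseteq> region X ` side_darts" "restrict_region ` ends G_X (Inr i) = across"
proof -
  have dirs: "UNIV = {Out, In}"
    using dir.exhaust by blast
  have X: "ends G_X (Inr i) =
      {region X (Point (Bottom Lft), Out), region X (Point (Bottom Rgt), In)}"
    using assms ends_side_graph[OF X_link X_alt, of "Inr i" sg]
      region_left_corner[OF assms] region_right_corner[OF assms]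
    by (simp add: crossings_X dirs)
  show "ends G_X (Inr i) \<subseteq> region X ` side_darts"
    unfolding X using end_points_in_side_darts by blast
  show "restrict_region ` ends G_X (Inr i) = across"
    unfolding X left_region_def right_region_def
    using region_Z_eq end_points_in_side_darts by simp
qed

lemma edges_G: "edges G_X = edges G_Z \<union> Inr ` {..<m}" "edges G_Z = crossings Z"
  by (simp_all add: checkerboard_graph_def crossings_X)

lemma ends_G_X_side_darts: "c \<in> edges G_X \<Longrightarrow> ends G_X c \<subseteq> region X ` side_darts"
  using ends_G_X_outer(1) ends_G_X_inner(1) by (auto simp: edges_G)

abbreviation "var \<equiv> if sg then w_var else r_var"

lemma weight_outer: "c \<in> crossings Z \<Longrightarrow> weight G_X c = weight G_Z c"
  by (auto simp: checkerboard_graph_def crossings_Z) (simp_all add: glue_def)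

lemma weight_inner: "weight G_X (Inr i) = var"
  by (simp add: checkerboard_graph_def glue_def twist_def)

text \<open>Restricting regions is the isomorphism from the simple graph of \<open>X\<close> to the
  enlarged one of \<open>Z\<close>. By \<open>no_edge_across\<close> no outer crossing is parallel
  to the twist, so the new edge has weight exactly \<open>var ^ m\<close>.\<close>

lemma cycle_poly_G_X:
  assumes "k \<ge> 2" and no_edge: "no_edge_across G_Z Z"
  shows "cycle_poly (merge_parallel G_X) k = cycle_poly
    \<lparr>sverts = UNIV, sedges = insert across (sedges (merge_parallel G_Z)),
     wg = (wg (merge_parallel G_Z))(across := var ^ m)\<rparr> k"
    (is "_ = cycle_poly ?K k")
proof (rule sym, rule cycle_poly_image[OF assms(1)])
  have no_edge: "ends G_Z c \<noteq> across" if "c \<in> crossings Z" for c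
    using no_edge that by (simp add: no_edge_across_def edges_G)
  have "\<Union> (sedges (merge_parallel G_X)) \<subseteq> region X ` side_darts"
    using ends_G_X_side_darts by (auto simp: merge_parallel_def)
  with inj_on_restrict_region
  show "inj_on restrict_region (\<Union> (sedges (merge_parallel G_X)))"
    by (rule inj_on_subset)
  show "\<Union> (sedges (merge_parallel G_X)) \<subseteq> sverts (merge_parallel G_X)"
    by (auto simp: merge_parallel_def checkerboard_graph_def)
  show "\<Union> (sedges ?K) \<subseteq> sverts ?K"
    by simp
  have "image restrict_region ` ends G_X ` Inr ` {..<m} = {across}"
    using ends_G_X_inner(2) m_pos by (auto simp: image_image)
  moreover have "image restrict_region ` ends G_X ` crossings Z = ends G_Z ` crossings Z"
    unfolding image_image using ends_G_X_outer(2) by (rule image_cong[OF refl])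
  ultimately show "sedges ?K = image restrict_region ` sedges (merge_parallel G_X)"
    by (simp add: merge_parallel_def edges_G image_Un)
  fix e assume "e \<in> sedges (merge_parallel G_X)"
  then obtain c where c: "c \<in> edges G_X" "e = ends G_X c"
    by (auto simp: merge_parallel_def)
  \<comment> \<open>By injectivity, parallel classes of \<open>G_X\<close> can be read off after
    restriction.\<close>
  have parallel: "ends G_X c' = e \<longleftrightarrow> restrict_region ` ends G_X c' = restrict_region ` e"
    if "c' \<in> edges G_X" for c'
    unfolding c(2)
    using inj_on_image_eq_iff[OF inj_on_restrict_region ends_G_X_side_darts[OF that]
        ends_G_X_side_darts[OF c(1)]] by (rule sym)
  have outer: "ends G_X c' = e \<longleftrightarrow> ends G_Z c' = restrict_region ` e" if "c' \<in> crossings Z" for c'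
    using parallel[of c'] that by (simp only: edges_G ends_G_X_outer(2) UnI1)
  have inner: "ends G_X (Inr i) = e \<longleftrightarrow> across = restrict_region ` e" if "i < m" for i
    using parallel[of "Inr i"] that by (simp only: edges_G ends_G_X_inner(2) UnI2 imageI lessThan_iff)
  show "wg ?K (restrict_region ` e) = wg (merge_parallel G_X) e"
  \<comment> \<open>A parallel class consists of outer crossings only or is the whole twist.\<close>
  proof (cases "c \<in> crossings Z")
    case True
    then have e: "ends G_Z c = restrict_region ` e"
      using c(2) ends_G_X_outer(2) by simp
    then have e_not: "across \<noteq> restrict_region ` e"
      using no_edge[OF True] by simp
    have "ends G_X c' \<noteq> e" if "c' \<in> Inr ` {..<m}" for c'
      using that inner e_not by (elim imageE) simp
    then have same: "{c' \<in> edges G_X. ends G_X c' = e} =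
        {c' \<in> edges G_Z. ends G_Z c' = restrict_region ` e}"
      unfolding edges_G by (intro Collect_cong) (metis Un_iff outer)
    have "(\<Prod>c'\<in>{c' \<in> edges G_Z. ends G_Z c' = restrict_region ` e}. weight G_X c') =
        (\<Prod>c'\<in>{c' \<in> edges G_Z. ends G_Z c' = restrict_region ` e}. weight G_Z c')"
      using weight_outer by (intro prod.cong) (simp_all add: edges_G)
    then show ?thesis
      using e_not[symmetric] same by (simp add: merge_parallel_def)
  next
    case False
    then obtain i where "i < m" "c = Inr i"
      using c(1) unfolding edges_G by blast
    then have e: "restrict_region ` e = across"
      using c(2) ends_G_X_inner(2) by simp
    have "ends G_X c' \<noteq> e" if "c' \<in> crossings Z" for c'
      using outer[OF that] no_edge[OF that] e by simp
    moreover have "ends G_X (Inr i) = e" if "i < m" for i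
      using inner[OF that] e by simp
    ultimately have "{c' \<in> edges G_X. ends G_X c' = e} = Inr ` {..<m}"
      unfolding edges_G by blast
    moreover have "(\<Prod>c'\<in>Inr ` {..<m}. weight G_X c') = var ^ m"
      by (subst prod.reindex) (simp_all add: weight_inner)
    ultimately show ?thesis
      by (simp add: merge_parallel_def e)
  qed
qed

end

section \<open>The recursions\<close>

text \<open>\<open>Q\<close> comes from the graph of the diagram with \<open>t_a\<close> before
  \<open>m\<close> is chosen, so twists of all lengths share it.\<close>

lemma cycle_poly_twist:
  fixes E :: "('c, 'p) tangle"
  assumes "k \<ge> 2" "link_diagram (glue E t_a)" "alternating (glue E t_a)"
    and "no_edge_across (side_graph sg (glue E t_a)) (glue E t_a)"
  shows "\<exists>Q. \<forall>m>0. link_diagram (glue E (twist sg m)) \<longrightarrow> alternating (glue E (twist sg m)) \<longrightarrow>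
    cycle_poly (merge_parallel (side_graph sg (glue E (twist sg m)))) k =
    cycle_poly (merge_parallel (side_graph sg (glue E t_a))) k + (if sg then w_var else r_var) ^ m * Q"
proof -
  let ?Z = "glue E t_a"
  let ?G = "merge_parallel (side_graph sg ?Z)"
  let ?e = "{left_region ?Z, right_region ?Z}"
  have fin: "finite (sedges ?G)"
    using assms(2) by (simp add: merge_parallel_def checkerboard_graph_def link_diagram_def)
  have verts: "\<Union> (sedges ?G) \<subseteq> sverts ?G"
    by (auto simp: merge_parallel_def checkerboard_graph_def)
  have new: "?e \<notin> sedges ?G"
    using assms(4) by (auto simp: merge_parallel_def no_edge_across_def)
  obtain Q where Q: "\<forall>x. cycle_poly
      \<lparr>sverts = UNIV, sedges = insert ?e (sedges ?G), wg = (wg ?G)(?e := x)\<rparr> k =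
      cycle_poly ?G k + x * Q"
    using cycle_poly_affine_in_weight[OF assms(1) fin verts new] by (rule exE)
  have "cycle_poly (merge_parallel (side_graph sg (glue E (twist sg m)))) k =
      cycle_poly ?G k + (if sg then w_var else r_var) ^ m * Q"
    if "m > 0" "link_diagram (glue E (twist sg m))" "alternating (glue E (twist sg m))" for m
  proof -
    interpret twist_insertion E sg m
      using that assms(2,3) by unfold_locales
    show ?thesis
      unfolding cycle_poly_G_X[OF assms(1,4)] by (rule Q[rule_format])
  qed
  then show ?thesis
    by blast
qed

text \<open>With \<open>P\<close> for \<open>t_a\<close> and \<open>x\<close> the variable,
  eliminating \<open>Q\<close> is the identity
  \<open>P + x^(2n+1) Q = x^(2n) (P + x Q) + (1 - x^(2n)) P\<close>.\<close>

lemma cycle_poly_odd_twist: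
  fixes E :: "('c, 'p) tangle"
  assumes "k \<ge> 2" "reduced_alternating_non_split (glue E (twist sg (2 * n + 1)))"
    "reduced_alternating_non_split (glue E (twist sg 1))"
    "reduced_alternating_non_split (glue E t_a)"
    "no_edge_across (side_graph sg (glue E t_a)) (glue E t_a)"
  shows "cycle_poly (merge_parallel (side_graph sg (glue E (twist sg (2 * n + 1))))) k =
    (if sg then w_var else r_var) ^ (2 * n) *
      cycle_poly (merge_parallel (side_graph sg (glue E (twist sg 1)))) k +
    (1 - (if sg then w_var else r_var) ^ (2 * n)) *
      cycle_poly (merge_parallel (side_graph sg (glue E t_a))) k"
proof -
  let ?x = "if sg then w_var else r_var"
  let ?P = "\<lambda>T. cycle_poly (merge_parallel (side_graph sg (glue E T))) k"
  have "link_diagram (glue E t_a)" "alternating (glue E t_a)"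
    using assms(4) by (simp_all add: reduced_alternating_non_split_def)
  then obtain Q where Q: "\<forall>m>0. link_diagram (glue E (twist sg m)) \<longrightarrow>
      alternating (glue E (twist sg m)) \<longrightarrow> ?P (twist sg m) = ?P t_a + ?x ^ m * Q"
    using cycle_poly_twist[OF assms(1) _ _ assms(5)] by blast
  have "?P (twist sg (2 * n + 1)) = ?P t_a + ?x ^ (2 * n + 1) * Q"
    using assms(2) by (intro Q[rule_format]) (simp_all add: reduced_alternating_non_split_def)
  moreover have "?P (twist sg 1) = ?P t_a + ?x ^ 1 * Q"
    using assms(3) by (intro Q[rule_format]) (simp_all add: reduced_alternating_non_split_def)
  ultimately show ?thesis
    by (simp only:) (simp add: algebra_simps)
qed

theorem theorem4p1:
  fixes k n :: nat
    and E F :: "('c, 'p) tangle"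
  assumes "k \<ge> 2"
  shows
    "(reduced_alternating_non_split (glue E (Wtr (2 * n + 1))) \<and>
      reduced_alternating_non_split (glue E t_c) \<and>
      reduced_alternating_non_split (glue E t_a) \<and>
      no_edge_across (G_B (glue E t_a)) (glue E t_a) \<longrightarrow>
        CB k (glue E (Wtr (2 * n + 1))) =
          r_var ^ (2 * n) * CB k (glue E t_c) + (1 - r_var ^ (2 * n)) * CB k (glue E t_a)) \<and>
     (reduced_alternating_non_split (glue F (Btw (2 * n + 1))) \<and>
      reduced_alternating_non_split (glue F t_b) \<and>
      reduced_alternating_non_split (glue F t_a) \<and>
      no_edge_across (G_W (glue F t_a)) (glue F t_a) \<longrightarrow>
        CW k (glue F (Btw (2 * n + 1))) =
          w_var ^ (2 * n) * CW k (glue F t_b) + (1 - w_var ^ (2 * n)) * CW k (glue F t_a))"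
proof -
  \<comment> \<open>Black regions flank negative twists and white ones positive twists, so the two
    claims are the instances \<open>False\<close> and \<open>True\<close> of one recursion.\<close>
  have black: "G_B D = side_graph False D" and white: "G_W D = side_graph True D"
    for D :: "('c + nat, ('p, unit) glued_point) diagram"
    by (simp_all add: G_B_def G_W_def side_regions_def)
  show ?thesis
    unfolding CB_def CW_def black white Wtr_def Btw_def t_b_def t_c_def
    using cycle_poly_odd_twist[OF assms, of E False n] cycle_poly_odd_twist[OF assms, of F True n]
    by (intro conjI impI; elim conjE) (simp_all only: if_True if_False)
qed

end
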